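(* Let $A^{(1)},\dots,A^{(K)}\in\mathbb{R}^{n\times n}$ be symmetric matrices, let $\boldsymbol{p}_k=[\underline{p}_k,\overline{p}_k]$, $k=1,\dots,K$, be compact real intervals, and let $\boldsymbol{p}=\boldsymbol{p}_1\times\dots\times\boldsymbol{p}_K$. For $p\in\mathbb{R}^K$ let $A(p)=\sum_{k=1}^K A^{(k)}p_k$. Let $p^0\in\boldsymbol{p}$ be arbitrarily chosen. Then the parametric matrix $A(p)$, $p\in\boldsymbol{p}$, is strongly positive definite if and only if the following two properties hold: (1) $A(p^0)$ is positive definite; (2) the parametric matrix $A(p)$, $p\in\boldsymbol{p}$, is regular.
   Context: The parametric matrix $A(p)$, $p\in\boldsymbol{p}$, is called strongly positive definite if $A(p)$ is positive definite for each $p\in\boldsymbol{p}$; it is called regular if $A(p)$ is nonsingular for each $p\in\boldsymbol{p}$. Intervals satisfy $\underline{p}_k\le\overline{p}_k$. Positive definite refers to real symmetric matrices. *)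

theory Defs
  imports "HOL-Analysis.Analysis"
begin

definition pos_def_matrix :: "real ^ 'n ^ 'n \<Rightarrow> bool" where
  "pos_def_matrix M \<longleftrightarrow>
     transpose M = M \<and> (\<forall>x :: real ^ 'n. x \<noteq> 0 \<longrightarrow> x \<bullet> (M *v x) > 0)"

definition param_matrix :: "('k :: finite \<Rightarrow> real ^ 'n ^ 'n) \<Rightarrow> real ^ 'k \<Rightarrow> real ^ 'n ^ 'n" where
  "param_matrix A p = (\<Sum>k\<in>UNIV. (p $ k) *\<^sub>R A k)"

definition strongly_pos_def ::
    "('k :: finite \<Rightarrow> real ^ 'n ^ 'n) \<Rightarrow> (real ^ 'k) set \<Rightarrow> bool" where
  "strongly_pos_def A P \<longleftrightarrow> (\<forall>p\<in>P. pos_def_matrix (param_matrix A p))"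

definition regular_param_matrix ::
    "('k :: finite \<Rightarrow> real ^ 'n ^ 'n) \<Rightarrow> (real ^ 'k) set \<Rightarrow> bool" where
  "regular_param_matrix A P \<longleftrightarrow> (\<forall>p\<in>P. invertible (param_matrix A p))"

end

theory Submission
  imports Defs
begin

text \<open>
  A positive definite matrix is nonsingular, which gives one direction. For the other, let
  \<open>M\<^sub>0 = A(p\<^sup>0)\<close> be positive definite and let \<open>M\<^sub>1 = A(p)\<close> for another \<open>p\<close> in the box. If
  \<open>M\<^sub>1\<close> is not positive definite, then the smallest value \<open>l\<close> of the generalized Rayleigh quotient
  \<open>(x \<bullet> M\<^sub>1 x) / (x \<bullet> M\<^sub>0 x)\<close>, attained by compactness of the unit sphere, is at most \<open>0\<close>. By
  minimality \<open>M\<^sub>1 - l M\<^sub>0\<close> is positive semidefinite, and its quadratic form vanishes at a minimizer,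
  so it is singular. As \<open>l \<le> 0\<close>, dividing by \<open>1 - l > 0\<close> turns this matrix into a convex
  combination of \<open>M\<^sub>0\<close> and \<open>M\<^sub>1\<close>. Since \<open>p \<mapsto> A(p)\<close> is linear, that combination is \<open>A(q)\<close> with
  \<open>q\<close> on the segment from \<open>p\<^sup>0\<close> to \<open>p\<close>, hence in the box, which contradicts regularity.
\<close>

lemma inner_symmetric_matrix_swap:
  fixes N :: "real ^ 'n ^ 'n"
  assumes "transpose N = N"
  shows "x \<bullet> (N *v y) = (N *v x) \<bullet> y"
  by (metis assms dot_lmul_matrix transpose_matrix_vector)

lemma invertible_iff_trivial_kernel:
  fixes M :: "real ^ 'n ^ 'n"
  shows "invertible M \<longleftrightarrow> (\<forall>x. M *v x = 0 \<longrightarrow> x = 0)"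
  by (simp add: invertible_left_inverse matrix_left_invertible_ker)

lemma pos_def_matrix_imp_invertible:
  assumes "pos_def_matrix M"
  shows "invertible M"
  using assms unfolding pos_def_matrix_def invertible_iff_trivial_kernel
  by (metis inner_zero_right less_irrefl)

text \<open>
  A zero \<open>x\<close> of a nonnegative quadratic form is a minimizer, so the form cannot decrease when \<open>x\<close> is
  moved against the gradient direction \<open>N x\<close>. This forces the gradient to vanish.
\<close>
lemma psd_isotropic_imp_kernel:
  fixes N :: "real ^ 'n ^ 'n"
  assumes sym: "transpose N = N"
    and psd: "\<And>y. 0 \<le> y \<bullet> (N *v y)"
    and zero: "x \<bullet> (N *v x) = 0"
  shows "N *v x = 0"
proof -
  define y where "y = N *v x"
  define c where "c = y \<bullet> (N *v y)"
  have c: "c \<ge> 0"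
    using psd by (simp add: c_def)
  \<comment> \<open>The step length minimizes \<open>- 2 t (y \<bullet> y) + t\<^sup>2 (c + 1)\<close>; the summand \<open>1\<close> covers \<open>c = 0\<close>.\<close>
  define t where "t = (y \<bullet> y) / (c + 1)"
  have xNy: "x \<bullet> (N *v y) = y \<bullet> y"
    using inner_symmetric_matrix_swap[OF sym, of x y] by (simp add: y_def)
  have "0 \<le> (x - t *\<^sub>R y) \<bullet> (N *v (x - t *\<^sub>R y))"
    by (rule psd)
  also have "\<dots> = - 2 * t * (y \<bullet> y) + t\<^sup>2 * c"
    using xNy zero
    by (simp add: matrix_vector_mult_diff_distrib matrix_vector_mult_scaleR inner_diff_left
        inner_diff_right power2_eq_square algebra_simps c_def flip: y_def)
  also have "y \<bullet> y = t * (c + 1)"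
    using c by (simp add: t_def)
  finally have "0 \<le> - (t\<^sup>2 * (c + 2))"
    by (simp add: power2_eq_square algebra_simps)
  then have "t\<^sup>2 * (c + 2) \<le> 0"
    by simp
  then have "t = 0"
    using c by (simp add: mult_le_0_iff)
  then show ?thesis
    using c by (simp add: t_def y_def)
qed

lemma rayleigh_quotient_attains_minimum:
  fixes M\<^sub>0 M\<^sub>1 :: "real ^ 'n ^ 'n"
  assumes pd: "\<And>x. x \<noteq> 0 \<Longrightarrow> 0 < x \<bullet> (M\<^sub>0 *v x)"
  obtains u where "u \<noteq> 0"
    and "\<And>x. x \<noteq> 0 \<Longrightarrow>
      (u \<bullet> (M\<^sub>1 *v u)) / (u \<bullet> (M\<^sub>0 *v u)) \<le> (x \<bullet> (M\<^sub>1 *v x)) / (x \<bullet> (M\<^sub>0 *v x))"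
proof -
  define r where "r = (\<lambda>x. (x \<bullet> (M\<^sub>1 *v x)) / (x \<bullet> (M\<^sub>0 *v x)))"
  let ?S = "sphere (0 :: real ^ 'n) 1"
  have "continuous_on ?S r"
    unfolding r_def
  proof (intro continuous_intros matrix_vector_mult_linear_continuous_on ballI)
    fix x :: "real ^ 'n"
    assume "x \<in> ?S"
    then have "x \<noteq> 0"
      by auto
    then show "x \<bullet> (M\<^sub>0 *v x) \<noteq> 0"
      using pd by fastforce
  qed
  moreover have "?S \<noteq> {}"
    by simp
  ultimately obtain u where u: "u \<in> ?S" and min: "\<And>y. y \<in> ?S \<Longrightarrow> r u \<le> r y"
    using continuous_attains_inf[OF compact_sphere, of 0 1 r] by blast
  show thesis
  proof
    show "u \<noteq> 0"
      using u by auto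
    fix x :: "real ^ 'n"
    assume "x \<noteq> 0"
    \<comment> \<open>The quotient is homogeneous of degree \<open>0\<close>, so its values on the sphere are all its values.\<close>
    then have "r ((1 / norm x) *\<^sub>R x) = r x"
      by (simp add: r_def matrix_vector_mult_scaleR)
    moreover have "(1 / norm x) *\<^sub>R x \<in> ?S"
      using \<open>x \<noteq> 0\<close> by simp
    ultimately show "(u \<bullet> (M\<^sub>1 *v u)) / (u \<bullet> (M\<^sub>0 *v u)) \<le> (x \<bullet> (M\<^sub>1 *v x)) / (x \<bullet> (M\<^sub>0 *v x))"
      using min unfolding r_def by metis
  qed
qed

text \<open>
  The smallest generalized eigenvalue \<open>l\<close> of \<open>M\<^sub>1\<close> relative to \<open>M\<^sub>0\<close> makes \<open>M\<^sub>1 - l M\<^sub>0\<close>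
  singular. If \<open>M\<^sub>1\<close> were not positive definite, then \<open>l \<le> 0\<close>, and a positive multiple of that matrix
  would lie on the segment.
\<close>
lemma pos_def_matrix_if_segment_invertible:
  fixes M\<^sub>0 M\<^sub>1 :: "real ^ 'n ^ 'n"
  assumes pd: "pos_def_matrix M\<^sub>0"
    and sym: "transpose M\<^sub>1 = M\<^sub>1"
    and inv: "\<And>t. 0 \<le> t \<Longrightarrow> t \<le> 1 \<Longrightarrow> invertible ((1 - t) *\<^sub>R M\<^sub>0 + t *\<^sub>R M\<^sub>1)"
  shows "pos_def_matrix M\<^sub>1"
proof -
  have sym0: "transpose M\<^sub>0 = M\<^sub>0" and pos: "\<And>x. x \<noteq> 0 \<Longrightarrow> 0 < x \<bullet> (M\<^sub>0 *v x)"
    using pd by (auto simp: pos_def_matrix_def)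
  obtain u where u: "u \<noteq> 0"
    and min: "\<And>x. x \<noteq> 0 \<Longrightarrow>
      (u \<bullet> (M\<^sub>1 *v u)) / (u \<bullet> (M\<^sub>0 *v u)) \<le> (x \<bullet> (M\<^sub>1 *v x)) / (x \<bullet> (M\<^sub>0 *v x))"
    using rayleigh_quotient_attains_minimum[OF pos] by blast
  define l where "l = (u \<bullet> (M\<^sub>1 *v u)) / (u \<bullet> (M\<^sub>0 *v u))"
  define N where "N = M\<^sub>1 - l *\<^sub>R M\<^sub>0"
  have N_mult: "N *v x = M\<^sub>1 *v x - l *\<^sub>R (M\<^sub>0 *v x)" for x
    by (simp add: N_def matrix_vector_mult_diff_rdistrib scaleR_matrix_vector_assoc)
  have "l > 0"
  proof (rule ccontr)
    assume "\<not> l > 0"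
    then have l: "l \<le> 0"
      by simp
    have "N *v u = 0"
    proof (rule psd_isotropic_imp_kernel)
      show "transpose N = N"
        using sym sym0 by (simp add: N_def transpose_def vec_eq_iff)
      show "u \<bullet> (N *v u) = 0"
        using pos[OF u] by (simp add: N_mult inner_diff_right l_def)
      show "0 \<le> x \<bullet> (N *v x)" for x
      proof (cases "x = 0")
        case False
        then show ?thesis
          using min[OF False] pos[OF False]
          by (simp add: N_mult inner_diff_right pos_le_divide_eq flip: l_def)
      qed simp
    qed
    define t where "t = 1 / (1 - l)"
    have t: "0 \<le> t" "t \<le> 1" "1 - t = - (t * l)"
      using l by (auto simp: t_def field_simps)
    have "(1 - t) *\<^sub>R M\<^sub>0 + t *\<^sub>R M\<^sub>1 = t *\<^sub>R N"
      by (simp add: t(3) N_def scaleR_diff_right)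
    then have "((1 - t) *\<^sub>R M\<^sub>0 + t *\<^sub>R M\<^sub>1) *v u = 0"
      using \<open>N *v u = 0\<close> by (simp flip: scaleR_matrix_vector_assoc)
    then show False
      using inv[OF t(1,2)] u unfolding invertible_iff_trivial_kernel by blast
  qed
  have "0 < x \<bullet> (M\<^sub>1 *v x)" if "x \<noteq> 0" for x
  proof -
    have "0 < (x \<bullet> (M\<^sub>1 *v x)) / (x \<bullet> (M\<^sub>0 *v x))"
      using \<open>l > 0\<close> min[OF that] by (simp add: l_def)
    then show ?thesis
      using pos[OF that] by (simp add: zero_less_divide_iff)
  qed
  with sym show ?thesis
    by (simp add: pos_def_matrix_def)
qed

lemma transpose_param_matrix:
  assumes "\<And>k. transpose (A k) = A k"
  shows "transpose (param_matrix A p) = param_matrix A p"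
proof -
  have "A k $ i $ j = A k $ j $ i" for k i j
    using arg_cong[OF assms[of k], of "\<lambda>M. M $ j $ i"] by (simp add: transpose_def)
  then show ?thesis
    by (simp add: param_matrix_def transpose_def vec_eq_iff)
qed

lemma param_matrix_affine_combination:
  "param_matrix A (s *\<^sub>R p + t *\<^sub>R q) = s *\<^sub>R param_matrix A p + t *\<^sub>R param_matrix A q"
  by (simp add: param_matrix_def scaleR_sum_right sum.distrib scaleR_add_left)

theorem theorem10:
  fixes A :: "'k :: finite \<Rightarrow> real ^ 'n ^ 'n"
    and p_lo p_hi p0 :: "real ^ 'k"
  assumes "\<And>k. transpose (A k) = A k"
    and "\<And>k. p_lo $ k \<le> p_hi $ k"
    and "p0 \<in> cbox p_lo p_hi"
  shows "strongly_pos_def A (cbox p_lo p_hi) \<longleftrightarrow>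
    pos_def_matrix (param_matrix A p0) \<and> regular_param_matrix A (cbox p_lo p_hi)"
proof
  assume "strongly_pos_def A (cbox p_lo p_hi)"
  then show "pos_def_matrix (param_matrix A p0) \<and> regular_param_matrix A (cbox p_lo p_hi)"
    using assms(3) pos_def_matrix_imp_invertible
    by (auto simp: strongly_pos_def_def regular_param_matrix_def)
next
  assume R: "pos_def_matrix (param_matrix A p0) \<and> regular_param_matrix A (cbox p_lo p_hi)"
  show "strongly_pos_def A (cbox p_lo p_hi)"
    unfolding strongly_pos_def_def
  proof
    fix p
    assume p: "p \<in> cbox p_lo p_hi"
    show "pos_def_matrix (param_matrix A p)"
    proof (rule pos_def_matrix_if_segment_invertible)
      show "pos_def_matrix (param_matrix A p0)"
        using R by blast
      show "transpose (param_matrix A p) = param_matrix A p"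
        by (rule transpose_param_matrix) (rule assms(1))
      fix t :: real
      assume "0 \<le> t" "t \<le> 1"
      then have "(1 - t) *\<^sub>R p0 + t *\<^sub>R p \<in> cbox p_lo p_hi"
        by (intro convexD[OF convex_box(1) assms(3) p]) auto
      then show "invertible ((1 - t) *\<^sub>R param_matrix A p0 + t *\<^sub>R param_matrix A p)"
        using R unfolding regular_param_matrix_def
        by (metis param_matrix_affine_combination)
    qed
  qed
qed

end
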